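(* Let $\boldsymbol\sigma=\{\sigma_i\}_{i=1}^d$ be a shape partition of a nonnegative tensor $\mathcal A\in\mathbb R_+^{N_1\times\cdots\times N_m}$ and let $\mathbf p=(p_1,\ldots,p_d)\in(1,\infty)^d$. Then: (i) If $\mathcal A$ is $\boldsymbol\sigma$-strictly nonnegative and $\sum_{i=1}^d|\sigma_i|/p_i<1$, then $$r^{(\boldsymbol\sigma,\mathbf p)}(\mathcal A)=\min_{\mathbf x\in\mathbb R^{\boldsymbol\sigma}_{++}}\left\{\max_{i\in[d],\,j_i\in[n_i]}\frac{\mathscr A_{s_i,j_i}(\mathbf x^{[\boldsymbol\sigma]})}{x_{i,j_i}^{p_i-1}}\;:\;\|\mathbf x_1\|_{p_1}\cdots\|\mathbf x_d\|_{p_d}\le 1\right\}.$$ (ii) If $\mathcal A$ is $\boldsymbol\sigma$-weakly irreducible and $\sum_{i=1}^d|\sigma_i|/p_i=1$, then $$r^{(\boldsymbol\sigma,\mathbf p)}(\mathcal A)=\min_{\mathbf x\in\mathbb R^{\boldsymbol\sigma}_{++}}\left\{\max_{i\in[d],\,j_i\in[n_i]}\frac{\mathscr A_{s_i,j_i}(\mathbf x^{[\boldsymbol\sigma]})}{x_{i,j_i}^{p_i-1}}\right\}.$$ (In both cases the minimum is attained.)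
   Context: Notation: $[n]=\{1,\ldots,n\}$; $\mathbb R_+$ and $\mathbb R_{++}$ are the nonnegative and positive reals; $\|\cdot\|_p$ is the $\ell_p$-norm. Shape partition: a partition $\boldsymbol\sigma=\{\sigma_i\}_{i=1}^d$ of $[m]$ such that (a) $N_j=N_{j'}$ for all $j,j'\in\sigma_i$ and all $i$; (b) $j\le k$ for all $j\in\sigma_i$, $k\in\sigma_{i+1}$; (c) $|\sigma_i|\le|\sigma_{i+1}|$ for $i\in[d-1]$. Put $\nu_i=|\sigma_i|$, $s_i=\min\sigma_i$, $n_i=N_{s_i}$. Let $\mathbb R^{\boldsymbol\sigma}=\mathbb R^{n_1}\times\cdots\times\mathbb R^{n_d}$, with elements $\mathbf x=(\mathbf x_1,\ldots,\mathbf x_d)$, $\mathbf x_i=(x_{i,1},\ldots,x_{i,n_i})$, and $\mathbb R^{\boldsymbol\sigma}_{+}$, $\mathbb R^{\boldsymbol\sigma}_{++}$ the subsets of entrywise nonnegative, resp. positive, elements. For $\mathbf x\in\mathbb R^{\boldsymbol\sigma}$, $\mathbf x^{[\boldsymbol\sigma]}=(\mathbf x_1,\ldots,\mathbf x_1,\ldots,\mathbf x_d,\ldots,\mathbf x_d)$ with $\mathbf x_i$ repeated $\nu_i$ times. For $\mathcal A=(a_{j_1\cdots j_m})$, $i\in[m]$, $j_i\in[N_i]$ and $(\mathbf z_1,\ldots,\mathbf z_m)\in\mathbb R^{N_1}\times\cdots\times\mathbb R^{N_m}$, $\mathscr A_{i,j_i}(\mathbf z_1,\ldots,\mathbf z_m)=\sum_{j_l\in[N_l],\,l\ne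 i}a_{j_1\cdots j_m}\prod_{l\neq i}z_{l,j_l}$, and $\mathscr A_i=(\mathscr A_{i,1},\ldots,\mathscr A_{i,N_i})$. A pair $(\lambda,\mathbf x)\in\mathbb R\times\mathbb R^{\boldsymbol\sigma}$ is a $(\boldsymbol\sigma,\mathbf p)$-eigenpair of $\mathcal A$ ($\lambda$ an eigenvalue, $\mathbf x$ an eigenvector) if $\mathscr A_{s_i}(\mathbf x^{[\boldsymbol\sigma]})=\lambda\,\psi_{p_i}(\mathbf x_i)$ and $\|\mathbf x_i\|_{p_i}=1$ for all $i\in[d]$, where $\psi_{p}(\mathbf v)$ has entries $|v_j|^{p-1}\mathrm{sign}(v_j)$. The $(\boldsymbol\sigma,\mathbf p)$-spectral radius is $r^{(\boldsymbol\sigma,\mathbf p)}(\mathcal A)=\sup\{|\lambda|:\lambda\text{ is a }(\boldsymbol\sigma,\mathbf p)\text{-eigenvalue of }\mathcal A\}$. Let $M$ be the square matrix of size $n_1+\cdots+n_d$ with $M_{(i,t_i),(j,l_j)}=\frac{\partial}{\partial x_{j,l_j}}\mathscr A_{s_i,t_i}(\mathbf x^{[\boldsymbol\sigma]})\big|_{\mathbf x=\mathbf 1}$. The nonnegative tensor $\mathcal A$ is $\boldsymbol\sigma$-strictly nonnegative if every row of $M$ has a nonzero entry, and $\boldsymbol\sigma$-weakly irreducible if $M$ is irreducible. *)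

theory Defs
  imports "HOL-Analysis.Analysis" "HOL-Library.Disjoint_Sets"
begin

text \<open>
  All indices start at 1. A tensor of size \<open>N 1 \<times> \<dots> \<times> N m\<close> is a function on the multi-indices
  below; its values elsewhere are never used.
\<close>

definition multi_indices :: "nat \<Rightarrow> (nat \<Rightarrow> nat) \<Rightarrow> (nat \<Rightarrow> nat) set" where
  "multi_indices m N = (\<Pi>\<^sub>E l\<in>{1..m}. {1..N l})"

definition nonneg_tensor :: "nat \<Rightarrow> (nat \<Rightarrow> nat) \<Rightarrow> ((nat \<Rightarrow> nat) \<Rightarrow> real) \<Rightarrow> bool" where
  "nonneg_tensor m N a \<longleftrightarrow> (\<forall>j\<in>multi_indices m N. 0 \<le> a j)"

text \<open>\<open>tensor_map m N a i k z\<close> is \<open>\<A>\<^bsub>i,k\<^esub>(z\<^sub>1, \<dots>, z\<^sub>m)\<close>.\<close>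

definition tensor_map ::
  "nat \<Rightarrow> (nat \<Rightarrow> nat) \<Rightarrow> ((nat \<Rightarrow> nat) \<Rightarrow> real) \<Rightarrow> nat \<Rightarrow> nat \<Rightarrow> (nat \<Rightarrow> nat \<Rightarrow> real) \<Rightarrow> real" where
  "tensor_map m N a i k z =
     (\<Sum>j\<in>{j \<in> multi_indices m N. j i = k}. a j * (\<Prod>l\<in>{1..m} - {i}. z l (j l)))"

definition shape_partition :: "nat \<Rightarrow> (nat \<Rightarrow> nat) \<Rightarrow> nat \<Rightarrow> (nat \<Rightarrow> nat set) \<Rightarrow> bool" where
  "shape_partition m N d \<sigma> \<longleftrightarrow>
     partition_on {1..m} (\<sigma> ` {1..d}) \<and> inj_on \<sigma> {1..d} \<and>
     (\<forall>i\<in>{1..d}. \<forall>j\<in>\<sigma> i. \<forall>j'\<in>\<sigma> i. N j = N j') \<and>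
     (\<forall>i\<in>{1..<d}. \<forall>j\<in>\<sigma> i. \<forall>k\<in>\<sigma> (Suc i). j \<le> k) \<and>
     (\<forall>i\<in>{1..<d}. card (\<sigma> i) \<le> card (\<sigma> (Suc i)))"

definition part_min :: "(nat \<Rightarrow> nat set) \<Rightarrow> nat \<Rightarrow> nat" where
  "part_min \<sigma> i = Min (\<sigma> i)"

definition part_dim :: "(nat \<Rightarrow> nat) \<Rightarrow> (nat \<Rightarrow> nat set) \<Rightarrow> nat \<Rightarrow> nat" where
  "part_dim N \<sigma> i = N (part_min \<sigma> i)"

definition coords :: "(nat \<Rightarrow> nat) \<Rightarrow> nat \<Rightarrow> (nat \<Rightarrow> nat set) \<Rightarrow> (nat \<times> nat) set" where
  "coords N d \<sigma> = (SIGMA i:{1..d}. {1..part_dim N \<sigma> i})"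

definition shape_space :: "(nat \<Rightarrow> nat) \<Rightarrow> nat \<Rightarrow> (nat \<Rightarrow> nat set) \<Rightarrow> (nat \<Rightarrow> nat \<Rightarrow> real) set" where
  "shape_space N d \<sigma> = (\<Pi>\<^sub>E i\<in>{1..d}. \<Pi>\<^sub>E j\<in>{1..part_dim N \<sigma> i}. UNIV)"

definition shape_space_pos :: "(nat \<Rightarrow> nat) \<Rightarrow> nat \<Rightarrow> (nat \<Rightarrow> nat set) \<Rightarrow> (nat \<Rightarrow> nat \<Rightarrow> real) set" where
  "shape_space_pos N d \<sigma> = {x \<in> shape_space N d \<sigma>. \<forall>(i, j)\<in>coords N d \<sigma>. 0 < x i j}"

text \<open>
  \<open>blow_up d \<sigma> x\<close> is \<open>x\<^bsup>[\<sigma>]\<^esup>\<close>: the tuple listing each \<open>x i\<close> \<open>card (\<sigma> i)\<close> times in succession,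
  as a function of the position \<open>l \<in> {1..m}\<close>.
\<close>

definition blow_up :: "nat \<Rightarrow> (nat \<Rightarrow> nat set) \<Rightarrow> (nat \<Rightarrow> nat \<Rightarrow> real) \<Rightarrow> nat \<Rightarrow> nat \<Rightarrow> real" where
  "blow_up d \<sigma> x l = concat (map (\<lambda>i. replicate (card (\<sigma> i)) (x i)) [1..<Suc d]) ! (l - 1)"

text \<open>\<open>shape_map m N a d \<sigma> i k x\<close> is \<open>\<A>\<^bsub>s\<^sub>i,k\<^esub>(x\<^bsup>[\<sigma>]\<^esup>)\<close>.\<close>

definition shape_map ::
  "nat \<Rightarrow> (nat \<Rightarrow> nat) \<Rightarrow> ((nat \<Rightarrow> nat) \<Rightarrow> real) \<Rightarrow> nat \<Rightarrow> (nat \<Rightarrow> nat set) \<Rightarrow>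
   nat \<Rightarrow> nat \<Rightarrow> (nat \<Rightarrow> nat \<Rightarrow> real) \<Rightarrow> real" where
  "shape_map m N a d \<sigma> i k x = tensor_map m N a (part_min \<sigma> i) k (blow_up d \<sigma> x)"

definition lp_norm :: "real \<Rightarrow> nat \<Rightarrow> (nat \<Rightarrow> real) \<Rightarrow> real" where
  "lp_norm q n v = (\<Sum>j=1..n. \<bar>v j\<bar> powr q) powr (1 / q)"

definition psi :: "real \<Rightarrow> real \<Rightarrow> real" where
  "psi q t = \<bar>t\<bar> powr (q - 1) * sgn t"

definition eigenpair ::
  "nat \<Rightarrow> (nat \<Rightarrow> nat) \<Rightarrow> ((nat \<Rightarrow> nat) \<Rightarrow> real) \<Rightarrow> nat \<Rightarrow> (nat \<Rightarrow> nat set) \<Rightarrow> (nat \<Rightarrow> real) \<Rightarrow>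
   real \<Rightarrow> (nat \<Rightarrow> nat \<Rightarrow> real) \<Rightarrow> bool" where
  "eigenpair m N a d \<sigma> p ev x \<longleftrightarrow>
     x \<in> shape_space N d \<sigma> \<and>
     (\<forall>i\<in>{1..d}.
        (\<forall>k\<in>{1..part_dim N \<sigma> i}. shape_map m N a d \<sigma> i k x = ev * psi (p i) (x i k)) \<and>
        lp_norm (p i) (part_dim N \<sigma> i) (x i) = 1)"

definition eigenvalue ::
  "nat \<Rightarrow> (nat \<Rightarrow> nat) \<Rightarrow> ((nat \<Rightarrow> nat) \<Rightarrow> real) \<Rightarrow> nat \<Rightarrow> (nat \<Rightarrow> nat set) \<Rightarrow> (nat \<Rightarrow> real) \<Rightarrow>
   real \<Rightarrow> bool" where
  "eigenvalue m N a d \<sigma> p ev \<longleftrightarrow> (\<exists>x. eigenpair m N a d \<sigma> p ev x)"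

text \<open>
  The supremum is taken in the extended reals, so that it is meaningful without knowing in advance
  that the set of eigenvalues is nonempty and bounded.
\<close>

definition tensor_spectral_radius ::
  "nat \<Rightarrow> (nat \<Rightarrow> nat) \<Rightarrow> ((nat \<Rightarrow> nat) \<Rightarrow> real) \<Rightarrow> nat \<Rightarrow> (nat \<Rightarrow> nat set) \<Rightarrow> (nat \<Rightarrow> real) \<Rightarrow>
   ereal" where
  "tensor_spectral_radius m N a d \<sigma> p = (SUP ev\<in>{ev. eigenvalue m N a d \<sigma> p ev}. ereal \<bar>ev\<bar>)"

definition all_ones :: "(nat \<Rightarrow> nat) \<Rightarrow> nat \<Rightarrow> (nat \<Rightarrow> nat set) \<Rightarrow> nat \<Rightarrow> nat \<Rightarrow> real" where
  "all_ones N d \<sigma> = (\<lambda>i\<in>{1..d}. \<lambda>j\<in>{1..part_dim N \<sigma> i}. 1)"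

definition jacobian ::
  "nat \<Rightarrow> (nat \<Rightarrow> nat) \<Rightarrow> ((nat \<Rightarrow> nat) \<Rightarrow> real) \<Rightarrow> nat \<Rightarrow> (nat \<Rightarrow> nat set) \<Rightarrow>
   nat \<times> nat \<Rightarrow> nat \<times> nat \<Rightarrow> real" where
  "jacobian m N a d \<sigma> = (\<lambda>(i, t) (j, l).
     deriv (\<lambda>u. shape_map m N a d \<sigma> i t
                  ((all_ones N d \<sigma>)(j := (all_ones N d \<sigma> j)(l := u)))) 1)"

text \<open>
  A matrix with rows and columns indexed by \<open>I\<close> is irreducible if no simultaneous permutation of
  rows and columns makes it block triangular with two nonempty diagonal blocks (\<open>S\<close> and \<open>I - S\<close>).
  Every \<open>1 \<times> 1\<close> matrix, including zero, counts as irreducible.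
\<close>

definition irreducible_on :: "'i set \<Rightarrow> ('i \<Rightarrow> 'i \<Rightarrow> real) \<Rightarrow> bool" where
  "irreducible_on I M \<longleftrightarrow>
     \<not> (\<exists>S. S \<noteq> {} \<and> S \<subset> I \<and> (\<forall>r\<in>S. \<forall>c\<in>I - S. M r c = 0))"

definition strictly_nonnegative ::
  "nat \<Rightarrow> (nat \<Rightarrow> nat) \<Rightarrow> ((nat \<Rightarrow> nat) \<Rightarrow> real) \<Rightarrow> nat \<Rightarrow> (nat \<Rightarrow> nat set) \<Rightarrow> bool" where
  "strictly_nonnegative m N a d \<sigma> \<longleftrightarrow>
     (\<forall>r\<in>coords N d \<sigma>. \<exists>c\<in>coords N d \<sigma>. jacobian m N a d \<sigma> r c \<noteq> 0)"

definition weakly_irreducible ::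
  "nat \<Rightarrow> (nat \<Rightarrow> nat) \<Rightarrow> ((nat \<Rightarrow> nat) \<Rightarrow> real) \<Rightarrow> nat \<Rightarrow> (nat \<Rightarrow> nat set) \<Rightarrow> bool" where
  "weakly_irreducible m N a d \<sigma> \<longleftrightarrow> irreducible_on (coords N d \<sigma>) (jacobian m N a d \<sigma>)"

definition max_ratio ::
  "nat \<Rightarrow> (nat \<Rightarrow> nat) \<Rightarrow> ((nat \<Rightarrow> nat) \<Rightarrow> real) \<Rightarrow> nat \<Rightarrow> (nat \<Rightarrow> nat set) \<Rightarrow> (nat \<Rightarrow> real) \<Rightarrow>
   (nat \<Rightarrow> nat \<Rightarrow> real) \<Rightarrow> real" where
  "max_ratio m N a d \<sigma> p x =
     Max ((\<lambda>(i, j). shape_map m N a d \<sigma> i j x / x i j powr (p i - 1)) ` coords N d \<sigma>)"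

end

theory Submission
  imports Defs
begin

text \<open>
  Multiplying \<open>\<A>\<^bsub>s\<^sub>i,k\<^esub>(x\<^bsup>[\<sigma>]\<^esup>)\<close> by \<open>x i k\<close> gives a map \<open>F\<close> whose monomials fill all \<open>m\<close> slots of the
  tensor, and positive eigenvectors are the positive solutions of \<open>F i k x = c * x i k powr p i\<close> with normalised parts.
  The proof has two halves.
  
  Upper bound (\<open>abs_eigenvalue_le_max_ratio\<close>). Every eigenvalue, of whatever sign and with an arbitrary real
  eigenvector \<open>z\<close>, is bounded in absolute value by the maximal ratio at every admissible positive \<open>x\<close>.
  One compares \<open>\<bar>z\<bar>\<close> with \<open>x\<close> part by part, at the indices where the quotient \<open>\<bar>z i k\<bar> / x i k\<close> is largest.
  
  Existence (\<open>positive_eigenvector_of_contraction\<close>, \<open>positive_eigenvector_of_irreducible\<close>). There is a positive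
  eigenvector. At such a vector all ratios equal the eigenvalue, so by the upper bound it is a minimiser,
  its eigenvalue is the spectral radius, and the minimum is attained. To find it, put
  \<open>x i k = exp (w (i, k) / p i)\<close>. In these coordinates \<open>ln F\<close> is monotone, and adding a constant \<open>t\<close> to
  all coordinates of \<open>w\<close> adds \<open>s * t\<close> to it, where \<open>s\<close> is the sum of the \<open>card (\<sigma> i) / p i\<close>. Such a map
  is \<open>s\<close>-Lipschitz for the maximum norm. If \<open>s < 1\<close>, it has a fixed point (\<open>fixed_point\<close>). If \<open>s = 1\<close>, it is
  nonexpansive and irreducibility provides an additive eigenvector (\<open>additive_eigenvector\<close>). The solution
  can be normalised with one common eigenvalue for all parts because contracting \<open>F\<close> with any part gives the
  same multilinear form (\<open>normalize_solution\<close>).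
  
  The only case escaping this scheme is a weakly irreducible tensor with a zero row: then there is a single
  index and the eigenvalue is \<open>0\<close> (\<open>zero_eigenpair_of_zero_row\<close>).
\<close>

section \<open>Monotone homogeneous maps on finitely many coordinates\<close>

lemma convergent_subsequence_on_finite:
  fixes v :: "nat \<Rightarrow> 'i \<Rightarrow> real"
  assumes "finite I" and "\<And>n i. i \<in> I \<Longrightarrow> \<bar>v n i\<bar> \<le> B"
  shows "\<exists>h l. strict_mono (h :: nat \<Rightarrow> nat) \<and> (\<forall>i\<in>I. (\<lambda>n. v (h n) i) \<longlonglongrightarrow> l i)"
  using assms
proof (induction I rule: finite_induct)
  case empty
  then show ?case using strict_mono_id by blast
next
  case (insert j I)
  then obtain h l where h: "strict_mono (h :: nat \<Rightarrow> nat)" "\<And>i. i \<in> I \<Longrightarrow> (\<lambda>n. v (h n) i) \<longlonglongrightarrow> l i"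
    by (metis insertCI)
  have "bounded (range (\<lambda>n. v (h n) j))"
    using insert.prems by (auto simp: bounded_iff)
  then obtain y g where g: "strict_mono (g :: nat \<Rightarrow> nat)" "((\<lambda>n. v (h n) j) \<circ> g) \<longlonglongrightarrow> y"
    using bounded_imp_convergent_subsequence by blast
  have "\<forall>i\<in>insert j I. (\<lambda>n. v ((h \<circ> g) n) i) \<longlonglongrightarrow> (l(j := y)) i"
    using g(2) LIMSEQ_subseq_LIMSEQ[OF h(2) g(1)] insert.hyps(2) by (auto simp: o_def)
  then show ?case using strict_mono_o[OF h(1) g(1)] by blast
qed

text \<open>
  For \<open>s = 1\<close> these maps are the topical maps of Gaubert and Gunawardena. Only the values on \<open>I\<close> of
  arguments and results matter; monotonicity in this form says in particular that \<open>H w r\<close> depends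
  only on \<open>w\<close> restricted to \<open>I\<close>.
\<close>

locale monotone_homogeneous_map =
  fixes I :: "'i set" and H :: "('i \<Rightarrow> real) \<Rightarrow> 'i \<Rightarrow> real" and s :: real
  assumes finite_I: "finite I" and I_nonempty: "I \<noteq> {}"
    and degree_nonneg: "0 \<le> s"
    and monotone_map: "\<And>u v r. r \<in> I \<Longrightarrow> (\<And>i. i \<in> I \<Longrightarrow> u i \<le> v i) \<Longrightarrow> H u r \<le> H v r"
    and translate: "\<And>w t r. r \<in> I \<Longrightarrow> H (\<lambda>i. w i + t) r = H w r + s * t"
begin

text \<open>
  If \<open>u\<close> and \<open>v\<close> differ by at most \<open>\<delta>\<close>, then \<open>u\<close> lies below the translate of \<open>v\<close> by \<open>\<delta>\<close>, and
  conversely. So \<open>H\<close> is Lipschitz with constant \<open>s\<close> for the maximum norm.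
\<close>

lemma lipschitz:
  assumes "r \<in> I" and "\<And>i. i \<in> I \<Longrightarrow> \<bar>u i - v i\<bar> \<le> \<delta>"
  shows "\<bar>H u r - H v r\<bar> \<le> s * \<delta>"
proof -
  have "H u r \<le> H v r + s * \<delta>" if "\<And>i. i \<in> I \<Longrightarrow> \<bar>u i - v i\<bar> \<le> \<delta>" for u v
  proof -
    have "H u r \<le> H (\<lambda>i. v i + \<delta>) r"
      by (rule monotone_map[OF assms(1)]) (use that in fastforce)
    then show ?thesis using translate[OF assms(1)] by simp
  qed
  from this[of u v] this[of v u] show ?thesis
    using assms(2) by (fastforce simp: abs_le_iff abs_minus_commute)
qed

lemma tendsto_map:
  assumes "r \<in> I" and "\<And>i. i \<in> I \<Longrightarrow> (\<lambda>n. u n i) \<longlonglongrightarrow> v i"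
  shows "(\<lambda>n. H (u n) r) \<longlonglongrightarrow> H v r"
proof -
  have "(\<lambda>n. s * (\<Sum>i\<in>I. \<bar>u n i - v i\<bar>)) \<longlonglongrightarrow> s * (\<Sum>i\<in>I. \<bar>v i - v i\<bar>)"
    by (intro tendsto_intros assms(2))
  then have lim: "(\<lambda>n. s * (\<Sum>i\<in>I. \<bar>u n i - v i\<bar>)) \<longlonglongrightarrow> 0" by simp
  have "\<bar>H (u n) r - H v r\<bar> \<le> s * (\<Sum>i\<in>I. \<bar>u n i - v i\<bar>)" for n
    by (rule lipschitz[OF assms(1)]) (auto intro!: member_le_sum finite_I)
  then have "(\<lambda>n. H (u n) r - H v r) \<longlonglongrightarrow> 0"
    by (intro Lim_null_comparison[OF _ lim]) simp
  then show ?thesis by (simp add: LIM_zero_iff)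
qed

text \<open>
  The contraction principle, run coordinatewise from \<open>0\<close>: the increments of the iterates decay like
  \<open>s ^ n\<close>.
\<close>

lemma fixed_point:
  assumes "s < 1"
  shows "\<exists>w. \<forall>r\<in>I. H w r = w r"
proof -
  define w where "w = (\<lambda>n. (H ^^ n) (\<lambda>_. 0))"
  have w_Suc: "w (Suc n) = H (w n)" for n by (simp add: w_def)
  define C where "C = (\<Sum>i\<in>I. \<bar>w 1 i - w 0 i\<bar>)"
  have step: "\<forall>i\<in>I. \<bar>w (Suc n) i - w n i\<bar> \<le> s ^ n * C" for n
  proof (induction n)
    case 0
    show ?case by (auto simp: C_def intro!: member_le_sum finite_I)
  next
    case (Suc n)
    show ?case
    proof
      fix i assume "i \<in> I"
      from lipschitz[OF this, of "w (Suc n)" "w n"] Suc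
      show "\<bar>w (Suc (Suc n)) i - w (Suc n) i\<bar> \<le> s ^ Suc n * C"
        by (simp add: w_Suc mult.assoc)
    qed
  qed
  have "convergent (\<lambda>n. w n i)" if "i \<in> I" for i
  proof -
    have "summable (\<lambda>n. s ^ n * C)"
      using assms degree_nonneg by (intro summable_mult2 summable_geometric) auto
    then have "summable (\<lambda>n. w (Suc n) i - w n i)"
      by (rule summable_comparison_test'[where N = 0]) (use step that in auto)
    then have "(\<lambda>n. (\<Sum>k<n. w (Suc k) i - w k i)) \<longlonglongrightarrow> (\<Sum>n. w (Suc n) i - w n i)"
      by (rule summable_LIMSEQ)
    then have "(\<lambda>n. w n i - w 0 i) \<longlonglongrightarrow> (\<Sum>n. w (Suc n) i - w n i)"
      by (simp only: sum_lessThan_telescope[of "\<lambda>n. w n i"])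
    then have "(\<lambda>n. (w n i - w 0 i) + w 0 i) \<longlonglongrightarrow> (\<Sum>n. w (Suc n) i - w n i) + w 0 i"
      by (intro tendsto_add tendsto_const)
    then show ?thesis by (auto simp: convergent_def)
  qed
  then obtain l where l: "\<And>i. i \<in> I \<Longrightarrow> (\<lambda>n. w n i) \<longlonglongrightarrow> l i"
    unfolding convergent_def by metis
  have "H l r = l r" if "r \<in> I" for r
  proof (rule LIMSEQ_unique)
    show "(\<lambda>n. w (Suc n) r) \<longlonglongrightarrow> H l r"
      unfolding w_Suc by (rule tendsto_map[OF that l])
    show "(\<lambda>n. w (Suc n) r) \<longlonglongrightarrow> l r"
      by (rule LIMSEQ_Suc[OF l[OF that]])
  qed
  then show ?thesis by blast
qed

text \<open>
  Existence in the borderline case, by vanishing discount. For \<open>\<alpha> < 1\<close> the map \<open>\<alpha> H\<close> is a contraction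
  and has a fixed point \<open>w\<close>. Subtracting the minimum \<open>min w\<close> gives \<open>v \<ge> 0\<close> with \<open>\<alpha> H v = v + \<eta>\<close>, where
  \<open>\<eta> = (1 - \<alpha>) min w\<close>. Evaluating at a minimal and at a maximal coordinate of \<open>v\<close> bounds \<open>\<eta>\<close> by the
  size of \<open>H 0\<close>. The hypothesis \<open>irreducible\<close> carries boundedness from one coordinate to the others:
  given a proper set \<open>S\<close> of coordinates on which \<open>v\<close> is bounded, it provides \<open>r\<close> in \<open>S\<close> and \<open>c\<close> outside
  such that the bound on \<open>v r\<close>, hence on \<open>H v r\<close>, bounds \<open>v c\<close> as well. The points \<open>v\<close> stay in a compact box, and a limit point as \<open>\<alpha>\<close> tends
  to \<open>1\<close> is the eigenvector.
  
  Normalising the minimum rather than the maximum matters, because \<open>irreducible\<close> speaks of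
  growth only: a large coordinate \<open>c\<close> forces \<open>H w r\<close> to be large, whereas a coordinate tending to \<open>-\<infinity>\<close>
  may leave \<open>H w r\<close> bounded below.
\<close>

lemma additive_eigenvector:
  assumes s: "s = 1"
    and irreducible: "\<And>S. S \<noteq> {} \<Longrightarrow> S \<subset> I \<Longrightarrow>
      \<exists>r\<in>S. \<exists>c\<in>I - S. \<forall>B. \<exists>B'. \<forall>w. (\<forall>i\<in>I. 0 \<le> w i) \<and> H w r \<le> B \<longrightarrow> w c \<le> B'"
  shows "\<exists>w \<eta>. \<forall>r\<in>I. H w r = w r + \<eta>"
proof -
  define C where "C = (\<Sum>i\<in>I. \<bar>H (\<lambda>_. 0) i\<bar>)"
  have C: "\<bar>H (\<lambda>_. 0) r\<bar> \<le> C" if "r \<in> I" for r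
    unfolding C_def using that by (auto intro!: member_le_sum finite_I)
  have C0: "0 \<le> C" by (simp add: C_def)
  \<comment> \<open>Every discounted solution with \<open>\<alpha> \<ge> 1/2\<close>, shifted to have minimum \<open>0\<close>, is \<open>good\<close>;
    this property retains no trace of \<open>\<alpha>\<close>, so the bounds below are uniform in \<open>\<alpha>\<close>.\<close>
  define good where "good = (\<lambda>w. (\<forall>i\<in>I. 0 \<le> w i) \<and> (\<forall>r\<in>I. H w r \<le> 2 * (w r + C)))"
  have bound1: "\<exists>B. \<forall>w. good w \<and> w r0 = 0 \<longrightarrow> w c \<le> B" if "r0 \<in> I" "c \<in> I" for r0 c
  proof -
    define S where "S = {c \<in> I. \<exists>B. \<forall>w. good w \<and> w r0 = 0 \<longrightarrow> w c \<le> B}"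
    have "r0 \<in> S" using that by (auto simp: S_def)
    have "S = I"
    proof (rule ccontr)
      assume "S \<noteq> I"
      then have "S \<subset> I" by (auto simp: S_def)
      with irreducible \<open>r0 \<in> S\<close> obtain r c' where rc: "r \<in> S" "c' \<in> I - S"
        "\<And>B. \<exists>B'. \<forall>w. (\<forall>i\<in>I. 0 \<le> w i) \<and> H w r \<le> B \<longrightarrow> w c' \<le> B'"
        by (metis empty_iff)
      from rc(1) obtain B where rI: "r \<in> I" and B: "\<And>w. good w \<Longrightarrow> w r0 = 0 \<Longrightarrow> w r \<le> B"
        by (auto simp: S_def)
      from rc(3)[of "2 * (B + C)"] obtain B'
        where B': "\<And>w. (\<forall>i\<in>I. 0 \<le> w i) \<Longrightarrow> H w r \<le> 2 * (B + C) \<Longrightarrow> w c' \<le> B'" by blast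
      have "w c' \<le> B'" if "good w" "w r0 = 0" for w
        using B[OF that] B'[of w] that(1) rI unfolding good_def by fastforce
      then have "c' \<in> S" using rc(2) by (auto simp: S_def)
      with rc(2) show False by simp
    qed
    with that show ?thesis by (auto simp: S_def)
  qed
  then obtain b where b: "\<And>r0 c w. r0 \<in> I \<Longrightarrow> c \<in> I \<Longrightarrow> good w \<Longrightarrow> w r0 = 0 \<Longrightarrow> w c \<le> b r0 c"
    by metis
  define B where "B = (\<Sum>r0\<in>I. \<Sum>c\<in>I. \<bar>b r0 c\<bar>)"
  have B: "w c \<le> B" if "r0 \<in> I" "c \<in> I" "good w" "w r0 = 0" for r0 c w
  proof -
    have "w c \<le> \<bar>b r0 c\<bar>" using b[OF that] by simp
    also have "\<dots> \<le> (\<Sum>c\<in>I. \<bar>b r0 c\<bar>)" using that by (intro member_le_sum finite_I) auto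
    also have "\<dots> \<le> B" unfolding B_def using that
      by (intro member_le_sum[of r0 I "\<lambda>r. \<Sum>c\<in>I. \<bar>b r c\<bar>"] finite_I) (auto intro: sum_nonneg)
    finally show ?thesis .
  qed
  define \<alpha> where "\<alpha> = (\<lambda>n. 1 - inverse (real (Suc (Suc n))))"
  have \<alpha>: "1 / 2 \<le> \<alpha> n" "\<alpha> n < 1" for n by (auto simp: \<alpha>_def field_simps)
  have "\<exists>v \<eta>. (\<forall>r\<in>I. \<alpha> n * H v r = v r + \<eta>) \<and> (\<forall>i\<in>I. \<bar>v i\<bar> \<le> B) \<and> \<bar>\<eta>\<bar> \<le> C" for n
  proof -
    have \<alpha>0: "0 < \<alpha> n" using \<alpha>[of n] by linarith
    interpret discounted: monotone_homogeneous_map I "\<lambda>w r. \<alpha> n * H w r" "\<alpha> n"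
      by unfold_locales
        (use finite_I I_nonempty \<alpha>0 monotone_map translate s in \<open>auto simp: algebra_simps\<close>)
    obtain w where w: "\<And>r. r \<in> I \<Longrightarrow> \<alpha> n * H w r = w r"
      using discounted.fixed_point \<alpha>(2) by blast
    obtain r0 where r0: "r0 \<in> I" "\<And>i. i \<in> I \<Longrightarrow> w r0 \<le> w i"
      using finite_I I_nonempty by (metis arg_min_if_finite(1) arg_min_least)
    obtain r1 where r1: "r1 \<in> I" "\<And>i. i \<in> I \<Longrightarrow> w i \<le> w r1"
      using finite_I I_nonempty arg_min_if_finite(1)[of I "\<lambda>i. - w i"]
        arg_min_least[of I _ "\<lambda>i. - w i"] by (metis neg_le_iff_le)
    define v where "v = (\<lambda>i. w i - w r0)"
    define \<eta> where "\<eta> = (1 - \<alpha> n) * w r0"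
    have v0: "0 \<le> v i" if "i \<in> I" for i using r0(2)[OF that] by (simp add: v_def)
    have eq: "\<alpha> n * H v r = v r + \<eta>" if "r \<in> I" for r
    proof -
      have "H w r = H v r + w r0"
        using translate[OF that, of w "- w r0"] by (simp add: v_def s)
      with w[OF that] have "\<alpha> n * H v r + \<alpha> n * w r0 = w r" by (simp flip: distrib_left)
      moreover have "v r = w r - w r0" by (simp add: v_def)
      ultimately show ?thesis by (simp add: \<eta>_def left_diff_distrib)
    qed
    \<comment> \<open>The minimal coordinate bounds \<open>\<eta>\<close> from below.\<close>
    have "\<eta> = \<alpha> n * H v r0" using eq[OF r0(1)] by (simp add: v_def)
    also have "\<dots> \<ge> \<alpha> n * H (\<lambda>_. 0) r0"
      using \<alpha>0 r0(1) v0 by (intro mult_left_mono monotone_map) auto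
    also have "\<alpha> n * H (\<lambda>_. 0) r0 \<ge> \<alpha> n * (- C)"
      using C[OF r0(1)] \<alpha>0 by (intro mult_left_mono) auto
    also have "\<alpha> n * (- C) \<ge> - C" using C0 \<alpha>[of n] by (simp add: mult_left_le_one_le)
    finally have lo: "- C \<le> \<eta>" by simp
    \<comment> \<open>The maximal coordinate bounds \<open>\<eta>\<close> from above.\<close>
    have "v r1 + \<eta> = \<alpha> n * H v r1" using eq[OF r1(1)] by simp
    also have "\<dots> \<le> \<alpha> n * H (\<lambda>i. 0 + v r1) r1"
      using \<alpha>0 r1 by (intro mult_left_mono monotone_map) (auto simp: v_def)
    also have "\<dots> = \<alpha> n * (H (\<lambda>_. 0) r1 + v r1)"
      by (subst translate[OF r1(1)]) (simp add: s)
    also have "\<dots> \<le> \<alpha> n * (C + v r1)"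
      using C[OF r1(1)] \<alpha>0 by (intro mult_left_mono) auto
    also have "\<dots> \<le> C + v r1"
      using C0 v0[OF r1(1)] \<alpha>[of n] by (intro mult_left_le_one_le) auto
    finally have hi: "\<eta> \<le> C" by simp
    have "H v r \<le> 2 * (v r + C)" if "r \<in> I" for r
    proof (cases "H v r \<le> 0")
      case True
      then show ?thesis using v0[OF that] C0 by simp
    next
      case False
      then have "1 / 2 * H v r \<le> \<alpha> n * H v r" using \<alpha>[of n] by (intro mult_right_mono) auto
      then show ?thesis using eq[OF that] hi by simp
    qed
    then have "good v" using v0 by (auto simp: good_def)
    moreover have "v r0 = 0" by (simp add: v_def)
    ultimately have "v i \<le> B" if "i \<in> I" for i
      using B[OF r0(1) that] by blast
    then show ?thesis using eq v0 lo hi by (metis abs_le_iff abs_of_nonneg minus_le_iff)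
  qed
  then obtain v \<eta> where v: "\<And>n r. r \<in> I \<Longrightarrow> \<alpha> n * H (v n) r = v n r + \<eta> n"
    "\<And>n i. i \<in> I \<Longrightarrow> \<bar>v n i\<bar> \<le> B" and \<eta>: "\<And>n. \<bar>\<eta> n\<bar> \<le> C"
    by metis
  obtain h l where h: "strict_mono (h :: nat \<Rightarrow> nat)" "\<And>i. i \<in> I \<Longrightarrow> (\<lambda>n. v (h n) i) \<longlonglongrightarrow> l i"
    using convergent_subsequence_on_finite[of I v B, OF finite_I v(2)] by blast
  have "\<alpha> \<longlonglongrightarrow> 1 - 0"
    unfolding \<alpha>_def by (rule tendsto_diff[OF tendsto_const LIMSEQ_Suc[OF LIMSEQ_inverse_real_of_nat]])
  then have \<alpha>_lim: "(\<lambda>n. \<alpha> (h n)) \<longlonglongrightarrow> 1"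
    using LIMSEQ_subseq_LIMSEQ[OF _ h(1)] by (simp add: o_def)
  have \<eta>_lim: "(\<lambda>n. \<eta> (h n)) \<longlonglongrightarrow> H l r - l r" if "r \<in> I" for r
  proof -
    have "(\<lambda>n. \<alpha> (h n) * H (v (h n)) r - v (h n) r) \<longlonglongrightarrow> 1 * H l r - l r"
      by (intro tendsto_intros \<alpha>_lim tendsto_map h(2) that)
    then show ?thesis using v(1)[OF that] by simp
  qed
  obtain r0 where "r0 \<in> I" using I_nonempty by blast
  have "H l r = l r + (H l r0 - l r0)" if "r \<in> I" for r
    using LIMSEQ_unique[OF \<eta>_lim[OF that] \<eta>_lim[OF \<open>r0 \<in> I\<close>]] by simp
  then show ?thesis by blast
qed

end

section \<open>The parts of a shape partition\<close>

lemma initial_segment_eq: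
  fixes U :: "nat set"
  assumes "finite U" and "\<And>x. x \<in> U \<Longrightarrow> 1 \<le> x"
    and "\<And>x y. x \<in> U \<Longrightarrow> 1 \<le> y \<Longrightarrow> y \<le> x \<Longrightarrow> y \<in> U"
  shows "U = {1..card U}"
proof (cases "U = {}")
  case True
  then show ?thesis by simp
next
  case False
  have "x \<in> U \<longleftrightarrow> x \<in> {1..Max U}" for x
  proof
    assume "x \<in> U"
    then show "x \<in> {1..Max U}" using assms(2)[of x] Max_ge[OF assms(1), of x] by simp
  next
    assume "x \<in> {1..Max U}"
    then have "1 \<le> x" "x \<le> Max U" by simp_all
    then show "x \<in> U" by (rule assms(3)[OF Max_in[OF assms(1) False]])
  qed
  then have eq: "U = {1..Max U}" by (rule set_eqI)
  have "card U = card {1..Max U}" by (rule arg_cong[OF eq])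
  also have "\<dots> = Max U" by simp
  finally show ?thesis using eq by (simp only:)
qed

lemma nth_concat_replicate:
  assumes "i \<in> {1..d}" and "(\<Sum>k=1..<i. c k) \<le> n" and "n < (\<Sum>k=1..i. c k)"
  shows "concat (map (\<lambda>i. replicate (c i) (f i)) [1..<Suc d]) ! n = f i"
proof -
  let ?blocks = "\<lambda>K. concat (map (\<lambda>i. replicate (c i) (f i)) K)"
  have "[1..<Suc d] = [1..<i] @ [i..<Suc d]"
    using assms(1) upt_add_eq_append[of 1 i "Suc d - i"] by auto
  also have "[i..<Suc d] = i # [Suc i..<Suc d]"
    using assms(1) by (intro upt_conv_Cons) auto
  finally have split: "?blocks [1..<Suc d] =
      ?blocks [1..<i] @ (replicate (c i) (f i) @ ?blocks [Suc i..<Suc d])"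
    by (simp only: map_append concat_append list.map concat.simps)
  have len: "length (?blocks [1..<i]) = (\<Sum>k=1..<i. c k)"
    by (simp add: length_concat o_def sum_list_distinct_conv_sum_set)
  have "{1..i} = insert i {1..<i}" using assms(1) by auto
  then have "(\<Sum>k=1..i. c k) = c i + (\<Sum>k=1..<i. c k)" by simp
  then have "n - (\<Sum>k=1..<i. c k) < c i" using assms(2,3) by linarith
  then have "(replicate (c i) (f i) @ ?blocks [Suc i..<Suc d]) ! (n - (\<Sum>k=1..<i. c k)) = f i"
    by (simp only: nth_append length_replicate if_True nth_replicate)
  then show ?thesis
    unfolding split nth_append[of "?blocks [1..<i]"] len using assms(2)
    by (simp only: linorder_not_less[symmetric] if_False)
qed

locale shaped_tensor =
  fixes m d :: nat and N :: "nat \<Rightarrow> nat" and a :: "(nat \<Rightarrow> nat) \<Rightarrow> real"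
    and \<sigma> :: "nat \<Rightarrow> nat set" and p :: "nat \<Rightarrow> real"
  assumes order_pos: "1 \<le> m" and dim_pos: "\<forall>l\<in>{1..m}. 1 \<le> N l"
    and tensor_nonneg: "nonneg_tensor m N a"
    and shape: "shape_partition m N d \<sigma>"
    and exponents: "\<forall>i\<in>{1..d}. 1 < p i"
begin

definition part_of :: "nat \<Rightarrow> nat" where
  "part_of l = (THE i. i \<in> {1..d} \<and> l \<in> \<sigma> i)"

abbreviation dim :: "nat \<Rightarrow> nat" where
  "dim i \<equiv> part_dim N \<sigma> i"

abbreviation indices :: "(nat \<times> nat) set" where
  "indices \<equiv> coords N d \<sigma>"

abbreviation monomials :: "nat \<Rightarrow> nat \<Rightarrow> (nat \<Rightarrow> nat) set" where
  "monomials i k \<equiv> {J \<in> multi_indices m N. J (part_min \<sigma> i) = k}"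

definition monomial :: "(nat \<Rightarrow> nat \<Rightarrow> real) \<Rightarrow> (nat \<Rightarrow> nat) \<Rightarrow> real" where
  "monomial x J = (\<Prod>l=1..m. x (part_of l) (J l))"

text \<open>
  This is \<open>x i k\<close> times \<open>shape_map m N a d \<sigma> i k x\<close> (see \<open>times_shape_map\<close>). The extra factor fills the
  slot \<open>s\<^sub>i\<close> that \<open>shape_map\<close> leaves open, so that every monomial runs over all \<open>m\<close> slots and has the
  same degree in each group of variables, whatever the row \<open>(i, k)\<close>.
\<close>

definition augmented_map :: "nat \<Rightarrow> nat \<Rightarrow> (nat \<Rightarrow> nat \<Rightarrow> real) \<Rightarrow> real" where
  "augmented_map i k x = (\<Sum>J\<in>monomials i k. a J * monomial x J)"

lemma parts_partition: "partition_on {1..m} (\<sigma> ` {1..d})"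
  using shape unfolding shape_partition_def by blast

lemma parts_inj: "inj_on \<sigma> {1..d}"
  using shape unfolding shape_partition_def by blast

lemma dims_constant:
  assumes "i \<in> {1..d}" "l \<in> \<sigma> i" "l' \<in> \<sigma> i"
  shows "N l = N l'"
proof -
  have "\<forall>i\<in>{1..d}. \<forall>j\<in>\<sigma> i. \<forall>j'\<in>\<sigma> i. N j = N j'"
    using shape unfolding shape_partition_def by (elim conjE) assumption
  from bspec[OF bspec[OF bspec[OF this assms(1)] assms(2)] assms(3)] show ?thesis .
qed

lemma parts_consecutive:
  assumes "i \<in> {1..<d}" "l \<in> \<sigma> i" "l' \<in> \<sigma> (Suc i)"
  shows "l \<le> l'"
  using shape assms unfolding shape_partition_def by blast

lemma Union_parts: "(\<Union>i\<in>{1..d}. \<sigma> i) = {1..m}"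
  using partition_onD1[OF parts_partition] by simp

lemma part_props:
  assumes "i \<in> {1..d}"
  shows part_nonempty: "\<sigma> i \<noteq> {}" and part_subset: "\<sigma> i \<subseteq> {1..m}" and finite_part: "finite (\<sigma> i)"
proof -
  show "\<sigma> i \<noteq> {}" using partition_onD3[OF parts_partition] assms by force
  show "\<sigma> i \<subseteq> {1..m}" using Union_parts assms by blast
  then show "finite (\<sigma> i)" using finite_subset by blast
qed

lemma parts_disjoint:
  assumes "i \<in> {1..d}" "j \<in> {1..d}" "i \<noteq> j"
  shows "\<sigma> i \<inter> \<sigma> j = {}"
proof (rule disjointD[OF partition_onD2[OF parts_partition]])
  show "\<sigma> i \<noteq> \<sigma> j" using inj_onD[OF parts_inj _ assms(1,2)] assms(3) by blast
qed (use assms(1,2) in \<open>simp_all only: imageI\<close>)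

lemma part_of_eq:
  assumes "i \<in> {1..d}" "l \<in> \<sigma> i"
  shows "part_of l = i"
  unfolding part_of_def using assms parts_disjoint by (intro the_equality) blast+

lemma part_of:
  assumes "l \<in> {1..m}"
  shows "part_of l \<in> {1..d}" "l \<in> \<sigma> (part_of l)"
proof -
  obtain i where "i \<in> {1..d}" "l \<in> \<sigma> i" using assms Union_parts by blast
  then show "part_of l \<in> {1..d}" "l \<in> \<sigma> (part_of l)" using part_of_eq by auto
qed

lemma part_count_pos: "1 \<le> d"
  using part_of[of 1] order_pos by auto

lemma part_min:
  assumes "i \<in> {1..d}"
  shows "part_min \<sigma> i \<in> \<sigma> i" "part_min \<sigma> i \<in> {1..m}" "part_of (part_min \<sigma> i) = i"
proof -
  show "part_min \<sigma> i \<in> \<sigma> i"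
    using part_props[OF assms] by (simp add: part_min_def)
  then show "part_min \<sigma> i \<in> {1..m}" "part_of (part_min \<sigma> i) = i"
    using part_subset[OF assms] part_of_eq[OF assms] by auto
qed

lemma dim_part_of:
  assumes "l \<in> {1..m}"
  shows "dim (part_of l) = N l"
  unfolding part_dim_def using part_of[OF assms] part_min(1)[OF part_of(1)[OF assms]]
  by (intro dims_constant) auto

lemma finite_multi_indices: "finite (multi_indices m N)"
  unfolding multi_indices_def by (intro finite_PiE) auto

lemma finite_indices: "finite indices"
  by (simp add: coords_def)

lemma multi_index_coords:
  assumes "J \<in> multi_indices m N" "l \<in> {1..m}"
  shows "(part_of l, J l) \<in> indices"
  using assms part_of(1)[OF assms(2)] dim_part_of[OF assms(2)]
  by (auto simp: coords_def multi_indices_def PiE_def Pi_def)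

lemma dim_ge_1:
  assumes "i \<in> {1..d}"
  shows "1 \<le> dim i"
  using part_min(2)[OF assms] dim_pos by (simp add: part_dim_def)

lemma parts_increasing:
  assumes "i \<in> {1..d}" "k \<in> {1..d}" "i < k" "x \<in> \<sigma> i" "y \<in> \<sigma> k"
  shows "x < y"
proof -
  have "i < k' \<Longrightarrow> k' \<le> d \<Longrightarrow> y \<in> \<sigma> k' \<Longrightarrow> x \<le> y" for k' y
  proof (induction k' arbitrary: y)
    case (Suc k')
    show ?case
    proof (cases "i = k'")
      case True
      then show ?thesis using parts_consecutive[of i x y] Suc.prems assms by simp
    next
      case False
      then have "k' \<in> {1..d}" "i < k'" using Suc.prems assms by auto
      then obtain z where "z \<in> \<sigma> k'" using part_nonempty by blast
      then show ?thesis
        using Suc.IH[of z] parts_consecutive[of k' z y] Suc.prems \<open>i < k'\<close> \<open>k' \<in> {1..d}\<close> by simp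
    qed
  qed simp
  then have "x \<le> y" using assms by simp
  moreover have "x \<noteq> y" using parts_disjoint[of i k] assms by auto
  ultimately show ?thesis by simp
qed

text \<open>
  The parts are consecutive intervals, so \<open>\<sigma> i\<close> occupies the same slots as the copies of \<open>x i\<close> in
  \<open>blow_up d \<sigma> x\<close>.
\<close>

lemma Union_initial_parts:
  assumes "i \<le> d"
  shows "(\<Union>k\<in>{1..i}. \<sigma> k) = {1..(\<Sum>k=1..i. card (\<sigma> k))}"
proof -
  let ?U = "\<Union>k\<in>{1..i}. \<sigma> k"
  have sub: "?U \<subseteq> {1..m}" using Union_parts assms by fastforce
  have closed: "y \<in> ?U" if xy: "x \<in> ?U" "1 \<le> y" "y \<le> x" for x y
  proof (rule ccontr)
    assume "y \<notin> ?U"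
    have y: "y \<in> {1..m}" using xy sub by fastforce
    obtain k where k: "k \<in> {1..i}" "x \<in> \<sigma> k" using xy by blast
    have "k < part_of y" using \<open>y \<notin> ?U\<close> part_of[OF y] k by fastforce
    then have "x < y"
      using parts_increasing[of k "part_of y" x y] part_of[OF y] k assms by simp
    with xy show False by simp
  qed
  have "?U = {1..card ?U}"
    by (rule initial_segment_eq) (use sub closed in \<open>auto intro: finite_subset\<close>)
  moreover have "card ?U = (\<Sum>k=1..i. card (\<sigma> k))"
    using assms finite_part parts_disjoint by (intro card_UN_disjoint) auto
  ultimately show ?thesis by simp
qed

lemma blow_up_eq:
  assumes "l \<in> {1..m}"
  shows "blow_up d \<sigma> x l = x (part_of l)"
proof -
  let ?i = "part_of l"
  note i = part_of[OF assms]
  have "l \<in> (\<Union>k\<in>{1..?i}. \<sigma> k)" using i by auto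
  then have up: "l \<le> (\<Sum>k=1..?i. card (\<sigma> k))" using Union_initial_parts[of ?i] i by auto
  have "l \<notin> (\<Union>k\<in>{1..?i - 1}. \<sigma> k)"
  proof
    assume "l \<in> (\<Union>k\<in>{1..?i - 1}. \<sigma> k)"
    then obtain k where "k \<in> {1..?i - 1}" "l \<in> \<sigma> k" by blast
    moreover from this i(1) have "k \<in> {1..d}" "k < ?i" by auto
    ultimately show False using part_of_eq[of k l] by simp
  qed
  moreover have "?i - 1 \<le> d" using i(1) by auto
  ultimately have "l \<notin> {1..(\<Sum>k=1..?i - 1. card (\<sigma> k))}"
    by (simp only: Union_initial_parts not_False_eq_True)
  moreover have "{1..?i - 1} = {1..<?i}" using i(1) by auto
  ultimately have lo: "(\<Sum>k=1..<?i. card (\<sigma> k)) < l"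
    using assms by (simp only: atLeastAtMost_iff simp_thms not_le)
  show ?thesis
    unfolding blow_up_def
    by (rule nth_concat_replicate) (use i up lo assms in auto)
qed

section \<open>The augmented map\<close>

lemma shape_map_eq:
  "shape_map m N a d \<sigma> i k x =
     (\<Sum>J\<in>monomials i k. a J * (\<Prod>l\<in>{1..m} - {part_min \<sigma> i}. x (part_of l) (J l)))"
  unfolding shape_map_def tensor_map_def
  by (intro sum.cong refl arg_cong2[where f = "(*)"] prod.cong) (auto simp: blow_up_eq)

lemma times_shape_map:
  assumes "i \<in> {1..d}"
  shows "x i k * shape_map m N a d \<sigma> i k x = augmented_map i k x"
  unfolding shape_map_eq augmented_map_def sum_distrib_left
proof (intro sum.cong refl)
  fix J assume "J \<in> monomials i k"
  then have "monomial x J = x i k * (\<Prod>l\<in>{1..m} - {part_min \<sigma> i}. x (part_of l) (J l))"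
    unfolding monomial_def
    using prod.remove[of "{1..m}" "part_min \<sigma> i" "\<lambda>l. x (part_of l) (J l)"] part_min[OF assms]
    by simp
  then show "x i k * (a J * (\<Prod>l\<in>{1..m} - {part_min \<sigma> i}. x (part_of l) (J l))) = a J * monomial x J"
    by simp
qed

text \<open>
  Contracting with \<open>x i\<close> closes the slot \<open>s\<^sub>i\<close>, so every part yields the same number: the multilinear form
  of the tensor with \<open>x (part_of l)\<close> in each slot \<open>l\<close>.
\<close>

lemma sum_augmented_map:
  assumes "i \<in> {1..d}"
  shows "(\<Sum>k=1..dim i. augmented_map i k x) = (\<Sum>J\<in>multi_indices m N. a J * monomial x J)"
  unfolding augmented_map_def
  by (rule sum.group)
    (use finite_multi_indices part_min(2)[OF assms] in
      \<open>auto simp: multi_indices_def part_dim_def PiE_def Pi_def\<close>)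

lemma coefficient_nonneg:
  assumes "J \<in> multi_indices m N"
  shows "0 \<le> a J"
  using tensor_nonneg assms by (simp add: nonneg_tensor_def)

lemma monomial_scale: "monomial (\<lambda>i j. c i * x i j) J = (\<Prod>l=1..m. c (part_of l)) * monomial x J"
  by (simp add: monomial_def prod.distrib)

lemma augmented_map_scale:
  "augmented_map i k (\<lambda>i j. c i * x i j) = (\<Prod>l=1..m. c (part_of l)) * augmented_map i k x"
  by (simp add: augmented_map_def monomial_scale sum_distrib_left algebra_simps)

lemma abs_augmented_map_le:
  assumes "\<And>i k. (i, k) \<in> indices \<Longrightarrow> \<bar>x i k\<bar> \<le> y i k"
  shows "\<bar>augmented_map i k x\<bar> \<le> augmented_map i k y"
proof -
  have "\<bar>a J * monomial x J\<bar> \<le> a J * monomial y J" if "J \<in> multi_indices m N" for J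
  proof -
    have "\<bar>monomial x J\<bar> \<le> monomial y J"
      unfolding monomial_def abs_prod
      using assms multi_index_coords[OF that] by (intro prod_mono) auto
    then show ?thesis
      using coefficient_nonneg[OF that] by (simp add: abs_mult mult_left_mono)
  qed
  then show ?thesis
    unfolding augmented_map_def by (intro order_trans[OF sum_abs] sum_mono) auto
qed

lemma augmented_map_cong:
  assumes "\<And>i k. (i, k) \<in> indices \<Longrightarrow> x i k = y i k"
  shows "augmented_map i k x = augmented_map i k y"
  unfolding augmented_map_def monomial_def
  by (intro sum.cong refl arg_cong2[where f = "(*)"] prod.cong)
    (use assms multi_index_coords in auto)

definition degree :: real where
  "degree = (\<Sum>i=1..d. real (card (\<sigma> i)) / p i)"

lemma degree_eq: "(\<Sum>l=1..m. 1 / p (part_of l)) = degree"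
proof -
  have "(\<Sum>l=1..m. 1 / p (part_of l)) = (\<Sum>i=1..d. \<Sum>l\<in>\<sigma> i. 1 / p (part_of l))"
    unfolding Union_parts[symmetric] by (rule sum.UNION_disjoint) (use finite_part parts_disjoint in auto)
  also have "\<dots> = (\<Sum>i=1..d. \<Sum>l\<in>\<sigma> i. 1 / p i)"
    using part_of_eq by (intro sum.cong) auto
  finally show ?thesis by (simp add: degree_def)
qed

end

section \<open>Collatz-Wielandt bound\<close>

lemma lp_norm_scale:
  assumes "0 < q" "0 \<le> c"
  shows "lp_norm q n (\<lambda>j. c * v j) = c * lp_norm q n v"
proof -
  have "(\<Sum>j=1..n. \<bar>c * v j\<bar> powr q) = c powr q * (\<Sum>j=1..n. \<bar>v j\<bar> powr q)"
    using assms by (simp add: abs_mult powr_mult sum_distrib_left)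
  then show ?thesis
    using assms by (simp add: lp_norm_def powr_mult sum_nonneg powr_powr)
qed

lemma lp_norm_mono:
  assumes "0 < q" "\<And>j. j \<in> {1..n} \<Longrightarrow> \<bar>v j\<bar> \<le> \<bar>w j\<bar>"
  shows "lp_norm q n v \<le> lp_norm q n w"
  unfolding lp_norm_def
  using assms by (intro powr_mono2 sum_mono sum_nonneg) auto

lemma psi_times_self: "t * psi q t = \<bar>t\<bar> powr q"
proof (cases "t = 0")
  case False
  then have "t * sgn t = \<bar>t\<bar> powr 1" using abs_sgn[of t] by simp
  then have "t * psi q t = \<bar>t\<bar> powr (q - 1) * \<bar>t\<bar> powr 1" by (simp add: psi_def algebra_simps)
  then show ?thesis by (simp only: powr_add[symmetric] diff_add_cancel)
qed simp

context shaped_tensor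
begin

lemma eigenpair_augmented_map:
  assumes "eigenpair m N a d \<sigma> p \<mu> z" "(i, k) \<in> indices"
  shows "augmented_map i k z = \<mu> * \<bar>z i k\<bar> powr p i"
proof -
  have i: "i \<in> {1..d}" "k \<in> {1..dim i}" using assms(2) by (auto simp: coords_def)
  then have "shape_map m N a d \<sigma> i k z = \<mu> * psi (p i) (z i k)"
    using assms(1) by (simp add: eigenpair_def)
  then show ?thesis
    using times_shape_map[OF i(1), where x = z and k = k] psi_times_self[of "z i k" "p i"]
    by (simp add: algebra_simps)
qed

text \<open>
  Write \<open>t\<close> for the maximal ratio at \<open>x\<close>, \<open>\<beta> i\<close> for the largest of the quotients \<open>\<bar>z i k\<bar> / x i k\<close>, and \<open>D\<close>
  for the product of \<open>\<beta> (part_of l)\<close> over all slots \<open>l\<close>. Comparing the eigenvalue equation for \<open>z\<close> with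
  the inequality for \<open>x\<close> at an index where \<open>\<beta> i\<close> is attained gives \<open>\<bar>\<mu>\<bar> (\<beta> i) powr (p i) \<le> t D\<close>.
  If \<open>t < \<bar>\<mu>\<bar>\<close>, then \<open>\<beta> i < D powr (1 / p i)\<close> for all \<open>i\<close>, and multiplying over the slots yields
  \<open>D < D powr degree\<close>. This is absurd for \<open>degree = 1\<close>. For \<open>degree < 1\<close> it forces \<open>D < 1\<close>, hence
  \<open>\<beta> i < 1\<close> for all \<open>i\<close>; but \<open>\<bar>z i\<bar> \<le> \<beta> i x i\<close> and \<open>z i\<close> has norm \<open>1\<close>, so the constraint on the norms of
  the \<open>x i\<close> makes the product of the \<open>\<beta> i\<close> at least \<open>1\<close>.
\<close>

lemma abs_eigenvalue_le_max_ratio: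
  assumes eig: "eigenpair m N a d \<sigma> p \<mu> z" and x: "x \<in> shape_space_pos N d \<sigma>"
    and deg: "degree = 1 \<or> degree < 1 \<and> (\<Prod>i=1..d. lp_norm (p i) (dim i) (x i)) \<le> 1"
  shows "\<bar>\<mu>\<bar> \<le> max_ratio m N a d \<sigma> p x"
proof (rule ccontr)
  define t where "t = max_ratio m N a d \<sigma> p x"
  assume "\<not> \<bar>\<mu>\<bar> \<le> max_ratio m N a d \<sigma> p x"
  then have less: "t < \<bar>\<mu>\<bar>" by (simp add: t_def)
  have x_pos: "0 < x i k" if "(i, k) \<in> indices" for i k
    using x that unfolding shape_space_pos_def by blast
  have t_bound: "augmented_map i k x \<le> t * x i k powr p i" if "(i, k) \<in> indices" for i k
  proof -
    have "shape_map m N a d \<sigma> i k x / x i k powr (p i - 1) \<le> t"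
      unfolding t_def max_ratio_def using that finite_indices by (intro Max_ge) auto
    then have "shape_map m N a d \<sigma> i k x \<le> t * x i k powr (p i - 1)"
      using x_pos[OF that] by (simp add: divide_le_eq)
    then have "x i k * shape_map m N a d \<sigma> i k x \<le> x i k * (t * x i k powr (p i - 1))"
      using x_pos[OF that] by (intro mult_left_mono) auto
    moreover have "x i k * x i k powr (p i - 1) = x i k powr p i"
      using x_pos[OF that] powr_add[of "x i k" 1 "p i - 1"] by simp
    ultimately show ?thesis
      using times_shape_map[of i x k] that by (simp add: coords_def algebra_simps)
  qed
  define \<beta> where "\<beta> = (\<lambda>i. Max ((\<lambda>k. \<bar>z i k\<bar> / x i k) ` {1..dim i}))"
  have z_le: "\<bar>z i k\<bar> \<le> \<beta> i * x i k" if "(i, k) \<in> indices" for i k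
  proof -
    have "\<bar>z i k\<bar> / x i k \<le> \<beta> i"
      unfolding \<beta>_def using that by (intro Max_ge) (auto simp: coords_def)
    then show ?thesis using x_pos[OF that] by (simp add: divide_le_eq)
  qed
  have norm_z: "lp_norm (p i) (dim i) (z i) = 1" if "i \<in> {1..d}" for i
    using eig that by (simp add: eigenpair_def)
  have \<beta>_pos: "0 < \<beta> i" and \<beta>_norm: "1 \<le> \<beta> i * lp_norm (p i) (dim i) (x i)"
    if i: "i \<in> {1..d}" for i
  proof -
    have p: "0 < p i" using exponents i by force
    obtain k where k: "k \<in> {1..dim i}" "z i k \<noteq> 0"
    proof (rule ccontr)
      assume "\<not> thesis"
      then have "\<And>k. k \<in> {1..dim i} \<Longrightarrow> z i k = 0" using that by blast
      then have "lp_norm (p i) (dim i) (z i) = 0" by (simp add: lp_norm_def)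
      then show False using norm_z[OF i] by simp
    qed
    have "(i, k) \<in> indices" using i k by (simp add: coords_def)
    then have "0 < \<beta> i * x i k" "0 < x i k" using z_le[of i k] k(2) x_pos by fastforce+
    then show "0 < \<beta> i" by (simp add: zero_less_mult_iff)
    then have "lp_norm (p i) (dim i) (z i) \<le> lp_norm (p i) (dim i) (\<lambda>k. \<beta> i * x i k)"
      using z_le i p by (intro lp_norm_mono) (force simp: coords_def intro: order_trans[OF _ abs_ge_self])+
    then show "1 \<le> \<beta> i * lp_norm (p i) (dim i) (x i)"
      using norm_z[OF i] lp_norm_scale[OF p, of "\<beta> i"] \<open>0 < \<beta> i\<close> by simp
  qed
  define D where "D = (\<Prod>l=1..m. \<beta> (part_of l))"
  have D_pos: "0 < D" unfolding D_def using \<beta>_pos part_of(1) by (intro prod_pos) auto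
  have \<beta>_less: "\<beta> i < D powr (1 / p i)" if i: "i \<in> {1..d}" for i
  proof -
    have p: "0 < p i" using exponents i by force
    have "\<beta> i \<in> (\<lambda>k. \<bar>z i k\<bar> / x i k) ` {1..dim i}"
      unfolding \<beta>_def using dim_ge_1[OF i] by (intro Max_in) auto
    then obtain k where k: "k \<in> {1..dim i}" "\<beta> i = \<bar>z i k\<bar> / x i k" by auto
    have ik: "(i, k) \<in> indices" using i k by (simp add: coords_def)
    have abs_z: "\<bar>z i k\<bar> = \<beta> i * x i k" using k x_pos[OF ik] by simp
    have "\<bar>\<mu>\<bar> * (\<beta> i powr p i * x i k powr p i) = \<bar>augmented_map i k z\<bar>"
      using eigenpair_augmented_map[OF eig ik] abs_z x_pos[OF ik] \<beta>_pos[OF i]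
      by (simp add: abs_mult powr_mult)
    also have "\<dots> \<le> augmented_map i k (\<lambda>i k. \<beta> i * x i k)"
      by (rule abs_augmented_map_le) (use z_le in auto)
    also have "\<dots> = D * augmented_map i k x"
      by (simp add: augmented_map_scale D_def)
    also have "\<dots> \<le> D * (t * x i k powr p i)"
      using t_bound[OF ik] D_pos by (intro mult_left_mono) auto
    also have "\<dots> < D * (\<bar>\<mu>\<bar> * x i k powr p i)"
      using less D_pos x_pos[OF ik] by simp
    finally have lt: "(\<bar>\<mu>\<bar> * x i k powr p i) * \<beta> i powr p i < (\<bar>\<mu>\<bar> * x i k powr p i) * D"
      by (simp add: algebra_simps)
    then have "\<bar>\<mu>\<bar> * x i k powr p i > 0" by (auto simp: less_le)
    with lt have "\<beta> i powr p i < D" by (simp only: mult_less_cancel_left_pos)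
    then have "(\<beta> i powr p i) powr (1 / p i) < D powr (1 / p i)"
      using p by (intro powr_less_mono2) auto
    then show ?thesis using p \<beta>_pos[OF i] by (simp add: powr_powr)
  qed
  have "(\<Prod>l=1..m. \<beta> (part_of l)) < (\<Prod>l=1..m. D powr (1 / p (part_of l)))"
    by (rule prod_mono_strict[of 1])
      (use order_pos \<beta>_less[OF part_of(1)] \<beta>_pos[OF part_of(1)] D_pos in \<open>auto intro: less_imp_le\<close>)
  then have "D < (\<Prod>l=1..m. D powr (1 / p (part_of l)))"
    unfolding D_def[symmetric] .
  also have "\<dots> = D powr degree"
    using D_pos by (simp add: powr_sum degree_eq[symmetric])
  finally have D_less: "D < D powr degree" .
  show False
  proof (cases "degree = 1")
    case True
    then show False using D_less D_pos by simp
  next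
    case False
    with deg have s: "degree < 1" and cons: "(\<Prod>i=1..d. lp_norm (p i) (dim i) (x i)) \<le> 1" by auto
    have "D < 1"
    proof (rule ccontr)
      assume "\<not> D < 1"
      then have "D powr degree \<le> D powr 1" using s by (intro powr_mono) auto
      then show False using D_less D_pos by simp
    qed
    have \<beta>_less_1: "\<beta> i < 1" if "i \<in> {1..d}" for i
    proof -
      have "D powr (1 / p i) \<le> 1 powr (1 / p i)"
      proof (rule powr_mono2)
        have "1 < p i" using exponents that by blast
        then show "0 \<le> 1 / p i" by simp
      qed (use \<open>D < 1\<close> D_pos in simp_all)
      then show ?thesis using \<beta>_less[OF that] by simp
    qed
    have "(\<Prod>i=1..d. \<beta> i) < (\<Prod>i=1..d. 1)"
      by (rule prod_mono_strict[of 1]) (use part_count_pos \<beta>_pos \<beta>_less_1 in \<open>auto intro: less_imp_le\<close>)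
    then have "(\<Prod>i=1..d. \<beta> i) < 1" by simp
    have "1 \<le> (\<Prod>i=1..d. \<beta> i * lp_norm (p i) (dim i) (x i))"
      using \<beta>_norm by (intro prod_ge_1) auto
    also have "\<dots> = (\<Prod>i=1..d. \<beta> i) * (\<Prod>i=1..d. lp_norm (p i) (dim i) (x i))"
      by (simp add: prod.distrib)
    also have "\<dots> \<le> (\<Prod>i=1..d. \<beta> i) * 1"
      using cons \<beta>_pos by (intro mult_left_mono prod_nonneg) (auto intro: less_imp_le)
    finally show False using \<open>(\<Prod>i=1..d. \<beta> i) < 1\<close> by simp
  qed
qed

lemma indices_nonempty: "indices \<noteq> {}"
  using part_count_pos dim_ge_1[of 1] by (force simp: coords_def)

lemma max_ratio_eigenpair:
  assumes "eigenpair m N a d \<sigma> p r u" "u \<in> shape_space_pos N d \<sigma>"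
  shows "max_ratio m N a d \<sigma> p u = r"
proof -
  have "(\<lambda>(i, j). shape_map m N a d \<sigma> i j u / u i j powr (p i - 1)) ` indices = (\<lambda>_. r) ` indices"
  proof (intro image_cong refl, clarify)
    fix i j assume "(i, j) \<in> indices"
    moreover from this have "0 < u i j" using assms(2) by (auto simp: shape_space_pos_def)
    ultimately show "shape_map m N a d \<sigma> i j u / u i j powr (p i - 1) = r"
      using assms(1) by (auto simp: eigenpair_def coords_def psi_def)
  qed
  then show ?thesis
    unfolding max_ratio_def using indices_nonempty by (simp add: image_constant_conv)
qed

text \<open>
  A positive eigenvector has all its ratios equal to its eigenvalue, so the general bound makes it both
  a minimiser of the maximal ratio and a witness for the supremum.
\<close>

lemma minimax_of_positive_eigenvector:
  assumes eig: "eigenpair m N a d \<sigma> p r u" and u: "u \<in> shape_space_pos N d \<sigma>" and "0 \<le> r"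
    and "Q u"
    and Q: "\<And>x. Q x \<Longrightarrow> x \<in> shape_space_pos N d \<sigma> \<and>
      (degree = 1 \<or> degree < 1 \<and> (\<Prod>i=1..d. lp_norm (p i) (dim i) (x i)) \<le> 1)"
  shows "is_arg_min (max_ratio m N a d \<sigma> p) Q u \<and>
    tensor_spectral_radius m N a d \<sigma> p = ereal (max_ratio m N a d \<sigma> p u)"
proof
  have bound: "\<bar>\<mu>\<bar> \<le> max_ratio m N a d \<sigma> p x" if "eigenvalue m N a d \<sigma> p \<mu>" "Q x" for \<mu> x
    using abs_eigenvalue_le_max_ratio that Q[OF that(2)] by (auto simp: eigenvalue_def)
  have ev: "eigenvalue m N a d \<sigma> p r" using eig by (auto simp: eigenvalue_def)
  note ratio = max_ratio_eigenpair[OF eig u]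
  show "is_arg_min (max_ratio m N a d \<sigma> p) Q u"
    using bound[OF ev] \<open>Q u\<close> by (fastforce simp: is_arg_min_def ratio)
  show "tensor_spectral_radius m N a d \<sigma> p = ereal (max_ratio m N a d \<sigma> p u)"
    unfolding tensor_spectral_radius_def
  proof (rule antisym)
    show "(SUP ev\<in>{ev. eigenvalue m N a d \<sigma> p ev}. ereal \<bar>ev\<bar>) \<le> ereal (max_ratio m N a d \<sigma> p u)"
      using bound \<open>Q u\<close> by (intro SUP_least) auto
    show "ereal (max_ratio m N a d \<sigma> p u) \<le> (SUP ev\<in>{ev. eigenvalue m N a d \<sigma> p ev}. ereal \<bar>ev\<bar>)"
      using ev \<open>0 \<le> r\<close> by (intro SUP_upper2[of r]) (auto simp: ratio)
  qed
qed

section \<open>Existence of a positive eigenvector\<close>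

text \<open>
  Summing the equation over \<open>k\<close> shows that the \<open>p i\<close>-th power of the norm of \<open>x i\<close> is one and the same
  number \<open>D\<close> for all \<open>i\<close>. Hence scaling each \<open>x i\<close> by \<open>D powr (- 1 / p i)\<close> normalises all parts, while
  multiplying all the augmented maps by the common factor \<open>D powr (- degree)\<close>: a single eigenvalue
  serves for all parts.
\<close>

lemma normalize_solution:
  assumes pos: "\<And>i k. (i, k) \<in> indices \<Longrightarrow> 0 < x i k" and "0 < c"
    and sol: "\<And>i k. (i, k) \<in> indices \<Longrightarrow> augmented_map i k x = c * x i k powr p i"
  obtains \<mu> u where "0 < \<mu>" "u \<in> shape_space_pos N d \<sigma>" "eigenpair m N a d \<sigma> p \<mu> u"
proof -
  define D where "D = (\<Sum>J\<in>multi_indices m N. a J * monomial x J) / c"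
  have power_sum: "(\<Sum>k=1..dim i. x i k powr p i) = D" if i: "i \<in> {1..d}" for i
  proof -
    have "c * (\<Sum>k=1..dim i. x i k powr p i) = (\<Sum>k=1..dim i. augmented_map i k x)"
      unfolding sum_distrib_left using sol i by (intro sum.cong) (auto simp: coords_def)
    then show ?thesis using sum_augmented_map[OF i] \<open>0 < c\<close> by (simp add: D_def field_simps)
  qed
  have "0 < D"
  proof -
    have "1 \<in> {1..d}" using part_count_pos by simp
    moreover have "0 < (\<Sum>k=1..dim 1. x 1 k powr p 1)"
      using pos[of 1 1] dim_ge_1[of 1] part_count_pos
      by (intro sum_pos2[where i = 1]) (auto simp: coords_def)
    ultimately show ?thesis using power_sum by simp
  qed
  define u where "u = (\<lambda>i\<in>{1..d}. \<lambda>k\<in>{1..dim i}. D powr (- 1 / p i) * x i k)"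
  have u_eq: "u i k = D powr (- 1 / p i) * x i k" if "(i, k) \<in> indices" for i k
    using that by (simp add: u_def coords_def)
  have u_pos: "0 < u i k" if "(i, k) \<in> indices" for i k
    using u_eq[OF that] pos[OF that] \<open>0 < D\<close> by simp
  have u_space: "u \<in> shape_space_pos N d \<sigma>"
    using u_pos by (auto simp: shape_space_pos_def shape_space_def u_def)
  define \<mu> where "\<mu> = D powr (1 - degree) * c"
  have u_power: "u i k powr p i = x i k powr p i / D" if "(i, k) \<in> indices" for i k
  proof -
    have "p i \<noteq> 0" using that exponents by (force simp: coords_def)
    then have "(D powr (- 1 / p i)) powr p i = D powr (- 1)" by (simp only: powr_powr) simp
    also have "\<dots> = 1 / D" using \<open>0 < D\<close> by (simp only: powr_neg_one)
    finally show ?thesis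
      unfolding u_eq[OF that] using pos[OF that] \<open>0 < D\<close> by (subst powr_mult) simp_all
  qed
  have total: "augmented_map i k u = \<mu> * u i k powr p i" if ik: "(i, k) \<in> indices" for i k
  proof -
    have "augmented_map i k u = augmented_map i k (\<lambda>i k. D powr (- 1 / p i) * x i k)"
      by (rule augmented_map_cong) (rule u_eq)
    also have "\<dots> = (\<Prod>l=1..m. D powr (- 1 / p (part_of l))) * augmented_map i k x"
      by (simp add: augmented_map_scale)
    also have "(\<Prod>l=1..m. D powr (- 1 / p (part_of l))) = D powr (- degree)"
      using \<open>0 < D\<close> by (simp add: powr_sum[symmetric] degree_eq[symmetric] sum_negf)
    also have "augmented_map i k x = c * D * u i k powr p i"
      using sol[OF ik] u_power[OF ik] \<open>0 < D\<close> by simp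
    also have "D powr (- degree) * (c * D * u i k powr p i) = \<mu> * u i k powr p i"
      using \<open>0 < D\<close> powr_add[of D "- degree" 1] by (simp add: \<mu>_def algebra_simps)
    finally show ?thesis .
  qed
  have "eigenpair m N a d \<sigma> p \<mu> u"
    unfolding eigenpair_def
  proof (intro conjI ballI)
    show "u \<in> shape_space N d \<sigma>" using u_space by (simp add: shape_space_pos_def)
    fix i assume i: "i \<in> {1..d}"
    show "shape_map m N a d \<sigma> i k u = \<mu> * psi (p i) (u i k)" if "k \<in> {1..dim i}" for k
    proof -
      have ik: "(i, k) \<in> indices" using i that by (simp add: coords_def)
      have "u i k * shape_map m N a d \<sigma> i k u = u i k * (\<mu> * psi (p i) (u i k))"
        using times_shape_map[OF i, where x = u and k = k] total[OF ik]
          psi_times_self[of "u i k" "p i"] u_pos[OF ik]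
        by (simp add: algebra_simps)
      then show ?thesis using u_pos[OF ik] by simp
    qed
    have "(\<Sum>k=1..dim i. \<bar>u i k\<bar> powr p i) = (\<Sum>k=1..dim i. x i k powr p i / D)"
    proof (intro sum.cong refl)
      fix k assume "k \<in> {1..dim i}"
      then have ik: "(i, k) \<in> indices" using i by (simp add: coords_def)
      show "\<bar>u i k\<bar> powr p i = x i k powr p i / D" using u_power[OF ik] u_pos[OF ik] by simp
    qed
    also have "\<dots> = 1" using power_sum[OF i] \<open>0 < D\<close> by (simp flip: sum_divide_distrib)
    finally show "lp_norm (p i) (dim i) (u i) = 1" by (simp add: lp_norm_def)
  qed
  moreover have "0 < \<mu>" using \<open>0 < D\<close> \<open>0 < c\<close> by (simp add: \<mu>_def)
  ultimately show thesis using that u_space by blast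
qed

abbreviation exp_point :: "(nat \<times> nat \<Rightarrow> real) \<Rightarrow> nat \<Rightarrow> nat \<Rightarrow> real" where
  "exp_point w \<equiv> (\<lambda>i k. exp (w (i, k) / p i))"

text \<open>
  The augmented map in logarithmic coordinates. The weight \<open>1 / p i\<close> turns the eigenvalue equation
  \<open>augmented_map i k x = c * x i k powr p i\<close> into \<open>log_map w (i, k) = w (i, k) + ln c\<close>. It also makes each
  monomial homogeneous of degree \<open>\<Sum>l. 1 / p (part_of l) = degree\<close> under simultaneous translation of all
  coordinates, so that the single number \<open>degree\<close> decides whether the map contracts.
\<close>

definition log_map :: "(nat \<times> nat \<Rightarrow> real) \<Rightarrow> nat \<times> nat \<Rightarrow> real" where
  "log_map w = (\<lambda>(i, k). ln (augmented_map i k (exp_point w)))"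

text \<open>
  Positivity of the augmented map on positive points. It follows from strict nonnegativity, and also
  from weak irreducibility as soon as there is more than one index.
\<close>

definition no_zero_row :: bool where
  "no_zero_row \<longleftrightarrow> (\<forall>(i, k)\<in>indices. \<exists>J\<in>monomials i k. 0 < a J)"

lemma exponent_pos:
  assumes "i \<in> {1..d}"
  shows "0 < p i"
proof -
  have "1 < p i" using exponents assms by blast
  then show ?thesis by simp
qed

lemma monomial_le_augmented_map:
  assumes "J \<in> monomials i k" and "\<And>i k. 0 \<le> x i k"
  shows "a J * monomial x J \<le> augmented_map i k x"
  unfolding augmented_map_def
proof (rule member_le_sum[OF assms(1)])
  show "finite (monomials i k)" using finite_multi_indices by simp
  show "0 \<le> a J * monomial x J" if "J \<in> monomials i k - {J'}" for J J'
    unfolding monomial_def using that coefficient_nonneg[of J] assms(2)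
    by (intro mult_nonneg_nonneg prod_nonneg) auto
qed

lemma augmented_map_pos:
  assumes "no_zero_row" "(i, k) \<in> indices" "\<And>i k. 0 < x i k"
  shows "0 < augmented_map i k x"
proof -
  obtain J where J: "J \<in> monomials i k" "0 < a J"
    using assms(1,2) by (auto simp: no_zero_row_def)
  have "0 < a J * monomial x J"
    unfolding monomial_def using J(2) assms(3) by (intro mult_pos_pos prod_pos) auto
  also have "\<dots> \<le> augmented_map i k x"
    using J(1) assms(3) by (intro monomial_le_augmented_map) (auto intro: less_imp_le)
  finally show ?thesis .
qed

lemma exp_log_map:
  assumes "no_zero_row" "(i, k) \<in> indices"
  shows "exp (log_map w (i, k)) = augmented_map i k (exp_point w)"
  using augmented_map_pos[OF assms, of "exp_point w"] by (simp add: log_map_def)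

lemma log_map_monotone_homogeneous:
  assumes "no_zero_row"
  shows "monotone_homogeneous_map indices log_map degree"
proof
  show "finite indices" by (rule finite_indices)
  show "indices \<noteq> {}" by (rule indices_nonempty)
  show "0 \<le> degree"
    unfolding degree_def using exponent_pos by (intro sum_nonneg divide_nonneg_pos) auto
  show "log_map u r \<le> log_map v r" if "r \<in> indices" "\<And>i. i \<in> indices \<Longrightarrow> u i \<le> v i" for u v r
  proof -
    obtain i k where r: "r = (i, k)" by (metis prod.exhaust)
    have "\<bar>exp_point u i k\<bar> \<le> exp_point v i k" if "(i, k) \<in> indices" for i k
      using \<open>\<And>i. i \<in> indices \<Longrightarrow> u i \<le> v i\<close>[OF that] exponent_pos[of i] that
      by (simp add: coords_def divide_right_mono)
    from abs_augmented_map_le[of "exp_point u" "exp_point v" i k, OF this]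
    have "augmented_map i k (exp_point u) \<le> augmented_map i k (exp_point v)"
      by linarith
    then have "exp (log_map u r) \<le> exp (log_map v r)"
      using exp_log_map[OF assms, of i k] \<open>r \<in> indices\<close> r by simp
    then show ?thesis by (simp only: exp_le_cancel_iff)
  qed
  show "log_map (\<lambda>i. w i + t) r = log_map w r + degree * t" if "r \<in> indices" for w t r
  proof -
    obtain i k where r: "r = (i, k)" by (metis prod.exhaust)
    have "exp_point (\<lambda>i. w i + t) = (\<lambda>i k. exp (t / p i) * exp_point w i k)"
      by (simp add: fun_eq_iff add_divide_distrib exp_add)
    then have "augmented_map i k (exp_point (\<lambda>i. w i + t)) =
        (\<Prod>l=1..m. exp (t / p (part_of l))) * augmented_map i k (exp_point w)"
      by (simp only: augmented_map_scale)
    also have "(\<Prod>l=1..m. exp (t / p (part_of l))) = exp (degree * t)"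
      unfolding degree_eq[symmetric] sum_distrib_right by (simp add: exp_sum)
    finally have "exp (log_map (\<lambda>i. w i + t) r) = exp (log_map w r + degree * t)"
      using exp_log_map[OF assms, of i k] that r by (simp add: exp_add mult.commute)
    then show ?thesis by (simp only: exp_inj_iff)
  qed
qed

text \<open>
  On nonnegative \<open>w\<close>, a single monomial of row \<open>(i, k)\<close> with a positive coefficient already bounds all the
  coordinates occurring in it by the value of \<open>log_map\<close> in that row.
\<close>

lemma log_map_coercive:
  assumes "no_zero_row" "(i, k) \<in> indices" "J \<in> monomials i k" "0 < a J" "l \<in> {1..m}"
    and "\<And>r. r \<in> indices \<Longrightarrow> 0 \<le> w r" "log_map w (i, k) \<le> B"
  shows "w (part_of l, J l) \<le> p (part_of l) * (B - ln (a J))"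
proof -
  have J: "J \<in> multi_indices m N" using assms(3) by simp
  let ?f = "\<lambda>l. w (part_of l, J l) / p (part_of l)"
  have "?f l \<le> sum ?f {1..m}"
    using assms(5,6) multi_index_coords[OF J] exponent_pos part_of(1)
    by (intro member_le_sum divide_nonneg_pos) auto
  then have "ln (a J) + ?f l \<le> ln (a J) + sum ?f {1..m}" by simp
  also have "\<dots> \<le> log_map w (i, k)"
  proof -
    have "exp (ln (a J) + sum ?f {1..m}) = a J * monomial (exp_point w) J"
      using assms(4) by (simp add: exp_add exp_sum monomial_def)
    also have "\<dots> \<le> exp (log_map w (i, k))"
      unfolding exp_log_map[OF assms(1,2)] by (rule monomial_le_augmented_map[OF assms(3)]) simp
    finally show ?thesis by (simp only: exp_le_cancel_iff)
  qed
  finally have "?f l \<le> B - ln (a J)" using assms(7) by linarith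
  then show ?thesis
    using exponent_pos[OF part_of(1)[OF assms(5)]] by (simp add: pos_divide_le_eq mult.commute)
qed

text \<open>
  If no monomial with a positive coefficient involves the variable \<open>(j, n)\<close>, then the function being
  differentiated is constant.
\<close>

lemma jacobian_nonzeroD:
  assumes "jacobian m N a d \<sigma> (i, k) (j, n) \<noteq> 0"
  obtains J l where "J \<in> monomials i k" "0 < a J" "l \<in> {1..m}" "(part_of l, J l) = (j, n)"
proof (rule ccontr)
  assume "\<not> thesis"
  then have none: "a J = 0 \<or> (\<forall>l\<in>{1..m}. \<not> (part_of l = j \<and> J l = n))" if "J \<in> monomials i k" for J
    using that \<open>\<And>J l. \<lbrakk>J \<in> monomials i k; 0 < a J; l \<in> {1..m}; (part_of l, J l) = (j, n)\<rbrakk> \<Longrightarrow> thesis\<close>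
      coefficient_nonneg[of J] by (fastforce simp: less_le)
  let ?x = "all_ones N d \<sigma>"
  have "shape_map m N a d \<sigma> i k (?x(j := (?x j)(n := u))) = shape_map m N a d \<sigma> i k ?x" for u
    unfolding shape_map_eq
  proof (intro sum.cong refl)
    fix J assume "J \<in> monomials i k"
    from none[OF this]
    show "a J * (\<Prod>l\<in>{1..m} - {part_min \<sigma> i}. (?x(j := (?x j)(n := u))) (part_of l) (J l)) =
        a J * (\<Prod>l\<in>{1..m} - {part_min \<sigma> i}. ?x (part_of l) (J l))"
    proof
      assume "\<forall>l\<in>{1..m}. \<not> (part_of l = j \<and> J l = n)"
      then show ?thesis by (intro arg_cong2[where f = "(*)"] prod.cong refl) auto
    qed simp
  qed
  then show False using assms by (simp add: jacobian_def)
qed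

lemma strictly_nonnegative_no_zero_row:
  assumes "strictly_nonnegative m N a d \<sigma>"
  shows "no_zero_row"
  unfolding no_zero_row_def
proof clarify
  fix i k assume "(i, k) \<in> indices"
  then obtain j n where "jacobian m N a d \<sigma> (i, k) (j, n) \<noteq> 0"
    using assms by (force simp: strictly_nonnegative_def)
  then show "\<exists>J\<in>monomials i k. 0 < a J" by (elim jacobian_nonzeroD) blast
qed

lemma positive_eigenvector_of_log_solution:
  assumes "no_zero_row" and "\<And>r. r \<in> indices \<Longrightarrow> log_map w r = w r + \<eta>"
  obtains \<mu> u where "0 \<le> \<mu>" "u \<in> shape_space_pos N d \<sigma>" "eigenpair m N a d \<sigma> p \<mu> u"
proof (rule normalize_solution)
  show "0 < exp_point w i k" for i k by simp
  show "0 < exp \<eta>" by simp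
  show "augmented_map i k (exp_point w) = exp \<eta> * exp_point w i k powr p i"
    if "(i, k) \<in> indices" for i k
  proof -
    have "p i \<noteq> 0" using that exponent_pos[of i] by (simp add: coords_def)
    then have "exp_point w i k powr p i = exp (w (i, k))" by (simp add: powr_def)
    then show ?thesis
      using exp_log_map[OF assms(1) that, of w] assms(2)[OF that] by (simp add: exp_add mult.commute)
  qed
qed (use that less_imp_le in blast)

lemma positive_eigenvector_of_contraction:
  assumes "strictly_nonnegative m N a d \<sigma>" "degree < 1"
  obtains \<mu> u where "0 \<le> \<mu>" "u \<in> shape_space_pos N d \<sigma>" "eigenpair m N a d \<sigma> p \<mu> u"
proof -
  note nz = strictly_nonnegative_no_zero_row[OF assms(1)]
  interpret log: monotone_homogeneous_map indices log_map degree
    by (rule log_map_monotone_homogeneous[OF nz])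
  obtain w where "\<forall>r\<in>indices. log_map w r = w r" using log.fixed_point[OF assms(2)] by blast
  then have "log_map w r = w r + 0" if "r \<in> indices" for r using that by simp
  from positive_eigenvector_of_log_solution[OF nz this] that show thesis by blast
qed

text \<open>
  A zero row of the tensor is a zero row of the Jacobian, which irreducibility tolerates only for
  \<open>1 \<times> 1\<close> matrices. Then the one-dimensional problem has the eigenvalue \<open>0\<close>.
\<close>

lemma zero_eigenpair_of_zero_row:
  assumes "weakly_irreducible m N a d \<sigma>" "\<not> no_zero_row"
  shows "all_ones N d \<sigma> \<in> shape_space_pos N d \<sigma>" "eigenpair m N a d \<sigma> p 0 (all_ones N d \<sigma>)"
proof -
  obtain i0 k0 where row: "(i0, k0) \<in> indices" "\<And>J. J \<in> monomials i0 k0 \<Longrightarrow> \<not> 0 < a J"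
    using assms(2) unfolding no_zero_row_def by blast
  have "jacobian m N a d \<sigma> (i0, k0) c = 0" for c
  proof (rule ccontr)
    assume "jacobian m N a d \<sigma> (i0, k0) c \<noteq> 0"
    then have "jacobian m N a d \<sigma> (i0, k0) (fst c, snd c) \<noteq> 0"
      by (simp only: prod.collapse not_False_eq_True)
    then show False by (rule jacobian_nonzeroD) (use row(2) in blast)
  qed
  then have "\<not> {(i0, k0)} \<subset> indices"
    using assms(1) unfolding weakly_irreducible_def irreducible_on_def by blast
  then have single: "indices = {(i0, k0)}" using row(1) by blast
  show "all_ones N d \<sigma> \<in> shape_space_pos N d \<sigma>"
    by (auto simp: all_ones_def shape_space_pos_def shape_space_def coords_def)
  have zero: "shape_map m N a d \<sigma> i0 k0 x = 0" for x
    unfolding shape_map_eq using row(2) coefficient_nonneg by (intro sum.neutral) (force simp: less_le)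
  show "eigenpair m N a d \<sigma> p 0 (all_ones N d \<sigma>)"
    unfolding eigenpair_def
  proof (intro conjI ballI)
    show "all_ones N d \<sigma> \<in> shape_space N d \<sigma>"
      by (auto simp: all_ones_def shape_space_def)
    fix i assume i: "i \<in> {1..d}"
    show "shape_map m N a d \<sigma> i k (all_ones N d \<sigma>) = 0 * psi (p i) (all_ones N d \<sigma> i k)"
      if "k \<in> {1..dim i}" for k
    proof -
      have "(i, k) \<in> indices" using i that by (simp add: coords_def)
      then show ?thesis using single zero by simp
    qed
    have "(i, 1) \<in> indices" "(i, dim i) \<in> indices" using i dim_ge_1[OF i] by (auto simp: coords_def)
    then have "dim i = 1" using single by simp
    then show "lp_norm (p i) (dim i) (all_ones N d \<sigma> i) = 1"
      using i by (simp add: lp_norm_def all_ones_def)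
  qed
qed

lemma positive_eigenvector_of_irreducible:
  assumes irr: "weakly_irreducible m N a d \<sigma>" and "degree = 1"
  obtains \<mu> u where "0 \<le> \<mu>" "u \<in> shape_space_pos N d \<sigma>" "eigenpair m N a d \<sigma> p \<mu> u"
proof (cases no_zero_row)
  case False
  then show thesis using zero_eigenpair_of_zero_row[OF irr] that[of 0] by blast
next
  case True
  interpret log: monotone_homogeneous_map indices log_map degree
    by (rule log_map_monotone_homogeneous[OF True])
  have "\<exists>w \<eta>. \<forall>r\<in>indices. log_map w r = w r + \<eta>"
  proof (rule log.additive_eigenvector[OF assms(2)])
    fix S :: "(nat \<times> nat) set" assume S: "S \<noteq> {}" "S \<subset> indices"
    then obtain r c where rc: "r \<in> S" "c \<in> indices - S" "jacobian m N a d \<sigma> r c \<noteq> 0"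
      using irr unfolding weakly_irreducible_def irreducible_on_def by blast
    obtain i k j n where ik: "r = (i, k)" "c = (j, n)" by (metis prod.exhaust)
    obtain J l where J: "J \<in> monomials i k" "0 < a J" "l \<in> {1..m}" "(part_of l, J l) = c"
      using rc(3) unfolding ik by (rule jacobian_nonzeroD) blast
    have "(i, k) \<in> indices" using rc(1) S(2) ik by blast
    then have "w c \<le> p (part_of l) * (B - ln (a J))"
      if "\<forall>r\<in>indices. 0 \<le> w r" "log_map w r \<le> B" for w B
      using log_map_coercive[OF True _ J(1-3), of w B] that J(4) ik by auto
    then show "\<exists>r\<in>S. \<exists>c\<in>indices - S. \<forall>B. \<exists>B'. \<forall>w.
        (\<forall>i\<in>indices. 0 \<le> w i) \<and> log_map w r \<le> B \<longrightarrow> w c \<le> B'"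
      using rc(1,2) by blast
  qed
  then obtain w \<eta> where "\<And>r. r \<in> indices \<Longrightarrow> log_map w r = w r + \<eta>" by blast
  from positive_eigenvector_of_log_solution[OF True this] that show thesis by blast
qed

end

theorem theorem3p1:
  fixes m d :: nat
    and N :: "nat \<Rightarrow> nat"
    and a :: "(nat \<Rightarrow> nat) \<Rightarrow> real"
    and \<sigma> :: "nat \<Rightarrow> nat set"
    and p :: "nat \<Rightarrow> real"
  assumes "1 \<le> m" and "\<forall>l\<in>{1..m}. 1 \<le> N l"
    and "nonneg_tensor m N a"
    and "shape_partition m N d \<sigma>"
    and "\<forall>i\<in>{1..d}. 1 < p i"
  shows
    "(strictly_nonnegative m N a d \<sigma> \<and> (\<Sum>i=1..d. real (card (\<sigma> i)) / p i) < 1 \<longrightarrow>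
        (\<exists>x. is_arg_min (max_ratio m N a d \<sigma> p)
               (\<lambda>x. x \<in> shape_space_pos N d \<sigma> \<and>
                    (\<Prod>i=1..d. lp_norm (p i) (part_dim N \<sigma> i) (x i)) \<le> 1) x \<and>
             tensor_spectral_radius m N a d \<sigma> p = ereal (max_ratio m N a d \<sigma> p x))) \<and>
     (weakly_irreducible m N a d \<sigma> \<and> (\<Sum>i=1..d. real (card (\<sigma> i)) / p i) = 1 \<longrightarrow>
        (\<exists>x. is_arg_min (max_ratio m N a d \<sigma> p)
               (\<lambda>x. x \<in> shape_space_pos N d \<sigma>) x \<and>
             tensor_spectral_radius m N a d \<sigma> p = ereal (max_ratio m N a d \<sigma> p x)))"
proof -
  interpret shaped_tensor m d N a \<sigma> p
    by (rule shaped_tensor.intro) (fact assms)+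
  show ?thesis
  proof (intro conjI impI; elim conjE)
    assume "strictly_nonnegative m N a d \<sigma>" and "(\<Sum>i=1..d. real (card (\<sigma> i)) / p i) < 1"
    then have deg: "degree < 1" by (simp add: degree_def)
    obtain \<mu> u where u: "0 \<le> \<mu>" "u \<in> shape_space_pos N d \<sigma>" "eigenpair m N a d \<sigma> p \<mu> u"
      using positive_eigenvector_of_contraction[OF \<open>strictly_nonnegative m N a d \<sigma>\<close> deg] .
    have "(\<Prod>i=1..d. lp_norm (p i) (dim i) (u i)) \<le> 1"
      using u(3) by (simp add: eigenpair_def)
    then show "\<exists>x. is_arg_min (max_ratio m N a d \<sigma> p)
        (\<lambda>x. x \<in> shape_space_pos N d \<sigma> \<and> (\<Prod>i=1..d. lp_norm (p i) (part_dim N \<sigma> i) (x i)) \<le> 1) x \<and>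
        tensor_spectral_radius m N a d \<sigma> p = ereal (max_ratio m N a d \<sigma> p x)"
      using u deg by (intro exI[of _ u] minimax_of_positive_eigenvector) auto
  next
    assume "weakly_irreducible m N a d \<sigma>" and "(\<Sum>i=1..d. real (card (\<sigma> i)) / p i) = 1"
    then have deg: "degree = 1" by (simp add: degree_def)
    obtain \<mu> u where u: "0 \<le> \<mu>" "u \<in> shape_space_pos N d \<sigma>" "eigenpair m N a d \<sigma> p \<mu> u"
      using positive_eigenvector_of_irreducible[OF \<open>weakly_irreducible m N a d \<sigma>\<close> deg] .
    then show "\<exists>x. is_arg_min (max_ratio m N a d \<sigma> p) (\<lambda>x. x \<in> shape_space_pos N d \<sigma>) x \<and>
        tensor_spectral_radius m N a d \<sigma> p = ereal (max_ratio m N a d \<sigma> p x)"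
      using deg by (intro exI[of _ u] minimax_of_positive_eigenvector) auto
  qed
qed

end
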